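(* Let $(\beta_i)_{i=0}^{\infty}$ be a sequence of positive real numbers with $\sum_{i=0}^{\infty}\beta_i<1$, let $\{H_n\}_{n\ge 1}$ be the discrete-time Hawkes process with parameters $(\beta_i)_{i\ge 0}$, and let $\Gamma_n(t)=\frac{1}{n}\log\mathbb{E}(e^{tH_n})$. Then for every $t<0$ the sequence $(\Gamma_n(t))_{n\ge 1}$ converges, as $n\to\infty$, to a finite limit $\Gamma(t)\in\mathbb{R}$.
   Context: Discrete-time Hawkes process (DTHP): on a probability space $(\Omega,\mathcal{F},\mathbb{P})$, let $(\xi_n)_{n\ge 1}$ be $\{0,1\}$-valued random variables with $\mathbb{P}(\xi_1=1)=\beta_0$ and, for $n\ge 2$, $\mathbb{P}(\xi_n=1\mid \xi_1,\ldots,\xi_{n-1})=\beta_0+\sum_{i=1}^{n-1}\beta_{n-i}\xi_i$ (and $\xi_n=0$ with the complementary conditional probability). The DTHP is $H_n=\sum_{i=1}^n\xi_i$, $n\ge 1$. *)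

theory Defs
  imports "HOL-Probability.Probability"
begin

text \<open>The sigma-algebra generated by \<open>\<xi>\<^sub>1, \<dots>, \<xi>\<^sub>n\<^sub>-\<^sub>1\<close>, i.e. by the random vector
  \<open>(\<xi>\<^sub>1, \<dots>, \<xi>\<^sub>n\<^sub>-\<^sub>1)\<close>; note that the interval \<open>{1..<n}\<close> excludes \<open>n\<close>.\<close>

definition history :: "'a measure \<Rightarrow> (nat \<Rightarrow> 'a \<Rightarrow> nat) \<Rightarrow> nat \<Rightarrow> 'a measure" where
  "history M \<xi> n = vimage_algebra (space M) (\<lambda>\<omega>. \<lambda>i\<in>{1..<n}. \<xi> i \<omega>)
                     (\<Pi>\<^sub>M i\<in>{1..<n}. count_space {0, 1})"

text \<open>The process is indexed from 1; the value \<open>\<xi> 0\<close> is irrelevant.  The conditional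
  probability of an event given \<open>\<xi>\<^sub>1, \<dots>, \<xi>\<^sub>n\<^sub>-\<^sub>1\<close> is the conditional expectation of its
  indicator, hence determined almost everywhere only.  The complementary law of
  \<open>\<xi>\<^sub>n = 0\<close> follows, since \<open>\<xi>\<^sub>n\<close> maps into \<open>{0, 1}\<close>.\<close>

locale dthp = prob_space M for M :: "'a measure" +
  fixes \<beta> :: "nat \<Rightarrow> real" and \<xi> :: "nat \<Rightarrow> 'a \<Rightarrow> nat"
  assumes binary: "\<And>n. n \<ge> 1 \<Longrightarrow> \<xi> n \<in> measurable M (count_space {0, 1})"
    and prob_first: "\<P>(\<omega> in M. \<xi> 1 \<omega> = 1) = \<beta> 0"
    and cond_prob_next: "\<And>n. n \<ge> 2 \<Longrightarrow>
      AE \<omega> in M. real_cond_exp M (history M \<xi> n) (indicator {\<omega> \<in> space M. \<xi> n \<omega> = 1}) \<omega>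
        = \<beta> 0 + (\<Sum>i=1..n-1. \<beta> (n - i) * real (\<xi> i \<omega>))"

definition hawkes :: "(nat \<Rightarrow> 'a \<Rightarrow> nat) \<Rightarrow> nat \<Rightarrow> 'a \<Rightarrow> nat" where
  "hawkes \<xi> n \<omega> = (\<Sum>i=1..n. \<xi> i \<omega>)"

definition log_mgf :: "'a measure \<Rightarrow> (nat \<Rightarrow> 'a \<Rightarrow> nat) \<Rightarrow> nat \<Rightarrow> real \<Rightarrow> real" where
  "log_mgf M H n t = (1 / real n) * ln (\<integral>\<omega>. exp (t * real (H n \<omega>)) \<partial>M)"

end

theory Submission
  imports Defs
begin

text \<open>For \<open>t < 0\<close> the sequence \<open>E (exp (t * H n))\<close> is submultiplicative.  Since the intensity is
  increasing in the set of past jumps, erasing the first \<open>n\<close> steps can only make later jumps rarer, so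
  given any past the conditional expectation of \<open>exp (t * (H (n + m) - H n))\<close> is at most
  \<open>E (exp (t * H m))\<close>.  Fekete's lemma then gives the limit, which is finite because
  \<open>H n \<le> n\<close>.\<close>

section \<open>Fekete's lemma\<close>

text \<open>Subtracting from \<open>u\<close> the line of slope \<open>u k / k\<close> leaves a
  subadditive sequence that vanishes at \<open>k\<close> and is therefore bounded above. After
  division by \<open>n\<close> this bound fades, so the averages eventually stay below any number
  exceeding \<open>u k / k\<close>.\<close>

lemma subadditive_fekete:
  fixes u :: "nat \<Rightarrow> real"
  assumes subadd: "\<And>m n. u (m + n) \<le> u m + u n"
    and bdd: "bdd_below ((\<lambda>n. u n / real n) ` {1..})"
  shows "(\<lambda>n. u n / real n) \<longlonglongrightarrow> (INF n\<in>{1..}. u n / real n)" (is "_ \<longlonglongrightarrow> ?L")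
proof (rule order_tendstoI)
  fix a assume a: "a < ?L"
  have "a < u n / real n" if "n \<ge> 1" for n
    using a cINF_lower[OF bdd, of n] that by auto
  then show "\<forall>\<^sub>F n in sequentially. a < u n / real n"
    by (auto simp: eventually_sequentially)
next
  fix a assume "?L < a"
  then obtain k where k: "k \<ge> 1" and ka: "u k / real k < a"
    using cINF_less_iff[OF _ bdd, of a] by auto
  define x where "x = u k / real k"
  define v where "v n = u n - real n * x" for n
  have vk: "v k = 0" using k by (simp add: v_def x_def)
  have vsub: "v (m + n) \<le> v m + v n" for m n
    using subadd[of m n] by (simp add: v_def algebra_simps)
  \<comment> \<open>Because \<open>v k = 0\<close>, passing from \<open>n - k\<close> to
    \<open>n\<close> cannot increase \<open>v\<close>; the values on one period below
    \<open>k\<close> thus bound all the others.\<close>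
  define C where "C = Max (v ` {..<k})"
  have vC: "v n \<le> C" for n
  proof (induction n rule: less_induct)
    case (less n)
    show ?case
    proof (cases "n < k")
      case True
      then show ?thesis by (simp add: C_def)
    next
      case False
      then show ?thesis
        using less[of "n - k"] vsub[of "n - k" k] vk k by simp
    qed
  qed
  have "(\<lambda>n. x + C / real n) \<longlonglongrightarrow> x + 0"
    by (intro tendsto_intros lim_const_over_n)
  then have "\<forall>\<^sub>F n in sequentially. x + C / real n < a"
    using ka by (intro order_tendstoD(2)) (auto simp: x_def)
  then show "\<forall>\<^sub>F n in sequentially. u n / real n < a"
    using eventually_gt_at_top[of 0]
  proof eventually_elim
    case (elim n)
    then show ?case using vC[of n] by (simp add: v_def field_simps)
  qed
qed

section \<open>Sets of lags and the recursion for the future transform\<close>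

text \<open>A past is encoded by its set of lags: \<open>j \<in> h\<close> means a jump \<open>j + 1\<close> steps before the
  present one.  Appending a step shifts the lags by \<open>Suc\<close>; no jumps before time \<open>1\<close> means
  that the initial past is \<open>{}\<close>.\<close>

definition intensity :: "(nat \<Rightarrow> real) \<Rightarrow> nat set \<Rightarrow> real" where
  "intensity \<beta> h = \<beta> 0 + (\<Sum>j. \<beta> (Suc j) * indicator h j)"

text \<open>This models the conditional expectation of \<open>exp (t * (H (n + m) - H n))\<close>
  given the past \<open>h\<close>, by conditioning on the next step. The recursion makes sense for
  every set \<open>h\<close>, not just almost surely, so different pasts can be compared
  pointwise.\<close>

primrec future_mgf :: "(nat \<Rightarrow> real) \<Rightarrow> real \<Rightarrow> nat \<Rightarrow> nat set \<Rightarrow> real" where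
  "future_mgf \<beta> t 0 h = 1"
| "future_mgf \<beta> t (Suc m) h =
     intensity \<beta> h * (exp t * future_mgf \<beta> t m (insert 0 (Suc ` h))) +
     (1 - intensity \<beta> h) * future_mgf \<beta> t m (Suc ` h)"

definition past :: "(nat \<Rightarrow> nat) \<Rightarrow> nat \<Rightarrow> nat set" where
  "past x n = {j. j < n \<and> x (n - j) = 1}"

lemma past_0 [simp]: "past x 0 = {}"
  by (simp add: past_def)

lemma past_Suc:
  "past x (Suc n) = (if x (Suc n) = 1 then insert 0 (Suc ` past x n) else Suc ` past x n)"
proof -
  have "j \<in> past x (Suc n) \<longleftrightarrow>
      j \<in> (if x (Suc n) = 1 then insert 0 (Suc ` past x n) else Suc ` past x n)" for j
    by (cases j) (auto simp: past_def)
  then show ?thesis by blast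
qed

lemma past_cong: "(\<And>i. i \<in> {1..n} \<Longrightarrow> x i = y i) \<Longrightarrow> past x n = past y n"
  by (auto simp: past_def)

section \<open>Monotonicity in the past\<close>

context
  fixes \<beta> :: "nat \<Rightarrow> real"
  assumes nonneg: "\<And>i. \<beta> i \<ge> 0" and summ: "summable \<beta>" and le1: "(\<Sum>i. \<beta> i) \<le> 1"
begin

lemma summable_intensity: "summable (\<lambda>j. \<beta> (Suc j) * indicator h j)"
  by (rule summable_comparison_test[OF _ summ[THEN summable_Suc_iff[THEN iffD2]]])
     (auto simp: nonneg indicator_def)

lemma intensity_mono: "h \<subseteq> h' \<Longrightarrow> intensity \<beta> h \<le> intensity \<beta> h'"
  unfolding intensity_def
  by (intro add_left_mono suminf_le summable_intensity) (auto simp: nonneg indicator_def)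

lemma intensity_nonneg: "intensity \<beta> h \<ge> 0"
  unfolding intensity_def
  by (intro add_nonneg_nonneg suminf_nonneg summable_intensity) (auto simp: nonneg)

text \<open>The largest intensity is that of the full set of lags, which is the whole sum of
  \<open>\<beta>\<close>. Intensities can therefore serve as weights of a convex
  combination.\<close>

lemma intensity_le_1: "intensity \<beta> h \<le> 1"
  using intensity_mono[of h UNIV] suminf_split_head[OF summ] le1
  by (simp add: intensity_def)

lemma future_mgf_nonneg: "future_mgf \<beta> t m h \<ge> 0"
  by (induction m arbitrary: h) (auto simp: intensity_nonneg intensity_le_1)

text \<open>Additional past jumps raise the present intensity and all later ones, and for
  \<open>t \<le> 0\<close> a jump can only lower the exponential.\<close>

lemma future_mgf_antimono:
  assumes "t \<le> 0" "h \<subseteq> h'"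
  shows "future_mgf \<beta> t m h' \<le> future_mgf \<beta> t m h"
  using assms(2)
proof (induction m arbitrary: h h')
  case (Suc m)
  define p q where "p = intensity \<beta> h" and "q = intensity \<beta> h'"
  define a b where "a = exp t * future_mgf \<beta> t m (insert 0 (Suc ` h))"
    and "b = future_mgf \<beta> t m (Suc ` h)"
  define a' b' where "a' = exp t * future_mgf \<beta> t m (insert 0 (Suc ` h'))"
    and "b' = future_mgf \<beta> t m (Suc ` h')"
  have pq: "p \<le> q" "0 \<le> p" "q \<le> 1"
    by (auto simp: p_def q_def intensity_mono Suc.prems intensity_nonneg intensity_le_1)
  have "a' \<le> a" "b' \<le> b"
    using Suc.prems by (auto simp: a_def b_def a'_def b'_def intro!: Suc.IH)
  \<comment> \<open>The jump branch is the smaller one: it carries the factor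
    \<open>exp t \<le> 1\<close>, and its extra lag \<open>0\<close> lowers the rest by the
    induction hypothesis.\<close>
  have "a \<le> 1 * future_mgf \<beta> t m (insert 0 (Suc ` h))"
    unfolding a_def using assms(1) by (intro mult_right_mono future_mgf_nonneg) simp
  also have "\<dots> \<le> b" unfolding b_def by (simp add: Suc.IH subset_insertI)
  finally have "a \<le> b" .
  \<comment> \<open>First the branches are compared under the same weight \<open>q\<close>; then
    weight moves from the smaller value \<open>a\<close> to the larger value \<open>b\<close> as
    \<open>q\<close> decreases to \<open>p\<close>.\<close>
  have "q * a' + (1 - q) * b' \<le> q * a + (1 - q) * b"
    using pq \<open>a' \<le> a\<close> \<open>b' \<le> b\<close> by (intro add_mono mult_left_mono) auto
  also have "\<dots> = b - q * (b - a)" by (simp add: algebra_simps)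
  also have "\<dots> \<le> b - p * (b - a)"
    using pq \<open>a \<le> b\<close> by (intro diff_left_mono mult_right_mono) auto
  also have "\<dots> = p * a + (1 - p) * b" by (simp add: algebra_simps)
  finally show ?case by (simp add: p_def q_def a_def b_def a'_def b'_def)
qed simp

end

section \<open>Measurability and integrability of functions of a finite past\<close>

text \<open>The product has finitely many points, and each singleton is a measurable box, so every
  subset is measurable.\<close>

lemma measurable_PiM_finite_count_space:
  fixes f :: "('i \<Rightarrow> 'b) \<Rightarrow> 'c::topological_space"
  assumes "finite I" "finite B"
  shows "f \<in> borel_measurable (\<Pi>\<^sub>M i\<in>I. count_space B)"
proof (rule measurableI)
  fix A :: "'c set"
  have fin: "finite (\<Pi>\<^sub>E i\<in>I. B)"
    using assms by (intro finite_PiE) auto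
  show "f -` A \<inter> space (\<Pi>\<^sub>M i\<in>I. count_space B) \<in> sets (\<Pi>\<^sub>M i\<in>I. count_space B)"
  proof (rule sets.countable)
    fix v assume "v \<in> f -` A \<inter> space (\<Pi>\<^sub>M i\<in>I. count_space B)"
    then have v: "v \<in> (\<Pi>\<^sub>E i\<in>I. B)" by (simp add: space_PiM)
    have "(\<Pi>\<^sub>E i\<in>I. {v i}) \<in> sets (\<Pi>\<^sub>M i\<in>I. count_space B)"
      using v assms by (intro sets_PiM_I_finite) auto
    then show "{v} \<in> sets (\<Pi>\<^sub>M i\<in>I. count_space B)"
      using v by (simp add: PiE_singleton PiE_iff)
  qed (use fin in \<open>auto simp: space_PiM intro: countable_finite\<close>)
qed simp

context dthp
begin

lemma binary_value: "n \<ge> 1 \<Longrightarrow> \<omega> \<in> space M \<Longrightarrow> \<xi> n \<omega> \<in> {0, 1}"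
  using measurable_space[OF binary[of n], of \<omega>] by simp

lemma past_vector_measurable:
  "(\<lambda>\<omega>. \<lambda>i\<in>{1..<n}. \<xi> i \<omega>) \<in> measurable M (\<Pi>\<^sub>M i\<in>{1..<n}. count_space {0, 1})"
  by (rule measurable_restrict, rule binary) simp

lemma finite_measure_subalgebra_history: "finite_measure_subalgebra M (history M \<xi> n)"
proof -
  have "sets (history M \<xi> n) \<subseteq> sets M"
    unfolding history_def by (intro sets_image_in_sets past_vector_measurable) simp
  then have "subalgebra M (history M \<xi> n)"
    by (simp add: subalgebra_def history_def)
  then show ?thesis
    by (simp add: finite_measure_subalgebra_def finite_measure_subalgebra_axioms_def
        finite_measure_axioms)
qed

text \<open>The assumption says that \<open>F\<close> reads only the coordinates
  \<open>1..<n\<close>. Hence \<open>F\<close> may be evaluated at the restricted vector that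
  generates the history.\<close>

lemma history_measurable:
  fixes F :: "(nat \<Rightarrow> nat) \<Rightarrow> real"
  assumes "\<And>x y. (\<And>i. i \<in> {1..<n} \<Longrightarrow> x i = y i) \<Longrightarrow> F x = F y"
  shows "(\<lambda>\<omega>. F (\<lambda>i. \<xi> i \<omega>)) \<in> borel_measurable (history M \<xi> n)"
proof -
  let ?V = "\<lambda>\<omega>. \<lambda>i\<in>{1..<n}. \<xi> i \<omega>"
  have "?V \<in> measurable (history M \<xi> n) (\<Pi>\<^sub>M i\<in>{1..<n}. count_space {0, 1})"
    unfolding history_def
    by (intro measurable_vimage_algebra1 Pi_I measurable_space[OF past_vector_measurable])
  then have "(\<lambda>\<omega>. F (?V \<omega>)) \<in> borel_measurable (history M \<xi> n)"
    by (rule measurable_compose) (simp add: measurable_PiM_finite_count_space)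
  moreover have "F (?V \<omega>) = F (\<lambda>i. \<xi> i \<omega>)" for \<omega>
    by (rule assms) simp
  ultimately show ?thesis by simp
qed

text \<open>Only finitely many binary vectors can occur as a past, so the maximum of
  \<open>\<bar>F\<bar>\<close> over them is a bound.\<close>

lemma integrable_history:
  fixes F :: "(nat \<Rightarrow> nat) \<Rightarrow> real"
  assumes "\<And>x y. (\<And>i. i \<in> {1..<n} \<Longrightarrow> x i = y i) \<Longrightarrow> F x = F y"
  shows "integrable M (\<lambda>\<omega>. F (\<lambda>i. \<xi> i \<omega>))"
proof -
  let ?V = "\<lambda>\<omega>. \<lambda>i\<in>{1..<n}. \<xi> i \<omega>"
  let ?S = "\<Pi>\<^sub>E i\<in>{1..<n}. {0, 1::nat}"
  interpret finite_measure_subalgebra M "history M \<xi> n"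
    by (rule finite_measure_subalgebra_history)
  have meas: "(\<lambda>\<omega>. F (\<lambda>i. \<xi> i \<omega>)) \<in> borel_measurable M"
    by (rule measurable_from_subalg[OF subalg history_measurable]) (rule assms)
  have fin: "finite ((\<lambda>v. \<bar>F v\<bar>) ` ?S)"
    by (intro finite_imageI finite_PiE) auto
  have "\<bar>F (\<lambda>i. \<xi> i \<omega>)\<bar> \<le> Max ((\<lambda>v. \<bar>F v\<bar>) ` ?S)" if "\<omega> \<in> space M" for \<omega>
  proof -
    have "?V \<omega> \<in> ?S" using binary_value that by auto
    moreover have "F (?V \<omega>) = F (\<lambda>i. \<xi> i \<omega>)"
      by (rule assms) simp
    ultimately have "\<bar>F (\<lambda>i. \<xi> i \<omega>)\<bar> \<in> (\<lambda>v. \<bar>F v\<bar>) ` ?S"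
      by (metis image_eqI)
    then show ?thesis using fin by (rule Max_ge[rotated])
  qed
  then show ?thesis
    by (intro integrable_const_bound[OF _ meas]) (auto intro!: AE_I2)
qed

section \<open>Conditioning on one step and on many steps\<close>

text \<open>This matches lags with times for the coming step \<open>Suc n\<close>: lag
  \<open>j\<close> is time \<open>i = n - j\<close>, so \<open>Suc j = Suc n - i\<close>. Binary
  values turn the indicator of the lag set into \<open>\<xi>\<close>.\<close>

lemma intensity_past:
  assumes "\<omega> \<in> space M"
  shows "intensity \<beta> (past (\<lambda>i. \<xi> i \<omega>) n) = \<beta> 0 + (\<Sum>i=1..n. \<beta> (Suc n - i) * real (\<xi> i \<omega>))"
proof -
  let ?h = "past (\<lambda>i. \<xi> i \<omega>) n"
  have "(\<Sum>j. \<beta> (Suc j) * indicator ?h j) = (\<Sum>j<n. \<beta> (Suc j) * indicator ?h j)"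
    by (rule suminf_finite) (auto simp: past_def)
  also have "\<dots> = (\<Sum>j<n. \<beta> (Suc j) * real (\<xi> (n - j) \<omega>))"
  proof (rule sum.cong)
    fix j assume "j \<in> {..<n}"
    then have "j < n" "n - j \<ge> 1" by auto
    then show "\<beta> (Suc j) * indicator ?h j = \<beta> (Suc j) * real (\<xi> (n - j) \<omega>)"
      using binary_value[of "n - j" \<omega>] assms by (auto simp: past_def indicator_def)
  qed simp
  also have "\<dots> = (\<Sum>i=1..n. \<beta> (Suc n - i) * real (\<xi> i \<omega>))"
    by (rule sum.reindex_bij_witness[of _ "\<lambda>i. n - i" "\<lambda>j. n - j"]) (auto simp: Suc_diff_le)
  finally show ?thesis by (simp add: intensity_def)
qed

text \<open>This is the defining conditional law in integrated form: under the integral, a function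
  of the past sees the jump indicator only through the intensity.\<close>

lemma integral_jump:
  fixes F :: "(nat \<Rightarrow> nat) \<Rightarrow> real"
  assumes F: "\<And>x y. (\<And>i. i \<in> {1..n} \<Longrightarrow> x i = y i) \<Longrightarrow> F x = F y"
  shows "(\<integral>\<omega>. F (\<lambda>i. \<xi> i \<omega>) * indicator {\<omega> \<in> space M. \<xi> (Suc n) \<omega> = 1} \<omega> \<partial>M) =
    (\<integral>\<omega>. F (\<lambda>i. \<xi> i \<omega>) * intensity \<beta> (past (\<lambda>i. \<xi> i \<omega>) n) \<partial>M)"
proof (cases "n = 0")
  case True
  \<comment> \<open>With no past, \<open>F\<close> is constant and the claim is the law of
    \<open>\<xi> 1\<close>; the conditional law starts only at index 2.\<close>
  have "F (\<lambda>i. \<xi> i \<omega>) = F (\<lambda>_. 0)" for \<omega>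
    by (rule F) (simp add: True)
  moreover have "prob ({\<omega> \<in> space M. \<xi> 1 \<omega> = 1} \<inter> space M) = \<beta> 0"
    by (subst Int_absorb2) (use prob_first in auto)
  ultimately show ?thesis
    using True by (simp add: intensity_def prob_space)
next
  case False
  then have n: "2 \<le> Suc n" by simp
  let ?F = "\<lambda>\<omega>. F (\<lambda>i. \<xi> i \<omega>)" and ?J = "{\<omega> \<in> space M. \<xi> (Suc n) \<omega> = 1}"
  let ?H = "history M \<xi> (Suc n)"
  interpret finite_measure_subalgebra M ?H
    by (rule finite_measure_subalgebra_history)
  have F': "F x = F y" if "\<And>i. i \<in> {1..<Suc n} \<Longrightarrow> x i = y i" for x y
    using that by (intro F) auto
  have J: "?J \<in> sets M"
    using measurable_sets[OF binary[of "Suc n"], of "{1}"]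
    by (simp add: vimage_def Int_def conj_commute)
  have int: "integrable M (\<lambda>\<omega>. ?F \<omega> * indicator ?J \<omega>)"
    by (rule integrable_real_mult_indicator[OF J integrable_history]) (rule F')
  have "(\<integral>\<omega>. ?F \<omega> * indicator ?J \<omega> \<partial>M) =
      (\<integral>\<omega>. ?F \<omega> * real_cond_exp M ?H (indicator ?J) \<omega> \<partial>M)"
  proof (rule real_cond_exp_intg(2)[symmetric, OF int history_measurable])
    show "indicator ?J \<in> borel_measurable M"
      using J by simp
  qed (rule F')
  also have "\<dots> = (\<integral>\<omega>. ?F \<omega> * intensity \<beta> (past (\<lambda>i. \<xi> i \<omega>) n) \<partial>M)"
  \<comment> \<open>The conditional probability is prescribed only almost everywhere, so
    measurability of both integrands has to be supplied.\<close>
  proof (rule integral_cong_AE)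
    show "(\<lambda>\<omega>. ?F \<omega> * real_cond_exp M ?H (indicator ?J) \<omega>) \<in> borel_measurable M"
      by (intro borel_measurable_times measurable_from_subalg[OF subalg history_measurable]
          borel_measurable_cond_exp2) (rule F')
    show "(\<lambda>\<omega>. ?F \<omega> * intensity \<beta> (past (\<lambda>i. \<xi> i \<omega>) n)) \<in> borel_measurable M"
    proof (rule measurable_from_subalg[OF subalg history_measurable])
      fix x y :: "nat \<Rightarrow> nat" assume xy: "\<And>i. i \<in> {1..<Suc n} \<Longrightarrow> x i = y i"
      then have "past x n = past y n" by (intro past_cong) auto
      then show "F x * intensity \<beta> (past x n) = F y * intensity \<beta> (past y n)"
        using F'[of x y] xy by simp
    qed
    show "AE \<omega> in M. ?F \<omega> * real_cond_exp M ?H (indicator ?J) \<omega> =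
        ?F \<omega> * intensity \<beta> (past (\<lambda>i. \<xi> i \<omega>) n)"
      using cond_prob_next[OF n] AE_space
    proof eventually_elim
      case (elim \<omega>)
      then show ?case using intensity_past[of \<omega> n] by simp
    qed
  qed
  finally show ?thesis .
qed

text \<open>This justifies reading \<open>future_mgf\<close> as a conditional expectation. Induction
  on \<open>m\<close> moves one step at a time from the future into the past, so \<open>n\<close>
  must stay arbitrary.\<close>

lemma integral_exp_hawkes_add:
  "(\<integral>\<omega>. exp (t * real (hawkes \<xi> (n + m) \<omega>)) \<partial>M) =
   (\<integral>\<omega>. exp (t * real (hawkes \<xi> n \<omega>)) * future_mgf \<beta> t m (past (\<lambda>i. \<xi> i \<omega>) n) \<partial>M)"
proof (induction m arbitrary: n)
  case (Suc m)
  \<comment> \<open>\<open>E\<close> is the weight of the first \<open>n\<close> steps;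
    \<open>A\<close> and \<open>B\<close> are the integrand at time \<open>Suc n\<close> with and
    without a jump there. All depend only on the coordinates \<open>1..n\<close>.\<close>
  define E where "E x = exp (t * real (\<Sum>i=1..n. x i))" for x :: "nat \<Rightarrow> nat"
  define A where "A x = E x * (exp t * future_mgf \<beta> t m (insert 0 (Suc ` past x n)))" for x
  define B where "B x = E x * future_mgf \<beta> t m (Suc ` past x n)" for x
  define P where "P x = intensity \<beta> (past x n)" for x
  have cong: "E x = E y \<and> past x n = past y n" if "\<And>i. i \<in> {1..n} \<Longrightarrow> x i = y i" for x y
    using past_cong[of n x y] that by (auto simp: E_def)
  have A: "A x = A y" and B: "B x = B y" and P: "P x = P y"
    if "\<And>i. i \<in> {1..n} \<Longrightarrow> x i = y i" for x y
    using cong[of x y] that by (auto simp: A_def B_def P_def)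
  have int: "integrable M (\<lambda>\<omega>. F (\<lambda>i. \<xi> i \<omega>))"
    if "\<And>x y. (\<And>i. i \<in> {1..n} \<Longrightarrow> x i = y i) \<Longrightarrow> F x = F y" for F :: "_ \<Rightarrow> real"
    by (rule integrable_history[of "Suc n"]) (rule that, auto)
  let ?\<xi> = "\<lambda>\<omega> i. \<xi> i \<omega>" and ?J = "{\<omega> \<in> space M. \<xi> (Suc n) \<omega> = 1}"
  have J: "?J \<in> sets M"
    using measurable_sets[OF binary[of "Suc n"], of "{1}"]
    by (simp add: vimage_def Int_def conj_commute)
  have intJ: "integrable M (\<lambda>\<omega>. F (?\<xi> \<omega>) * indicator ?J \<omega>)"
    if "\<And>x y. (\<And>i. i \<in> {1..n} \<Longrightarrow> x i = y i) \<Longrightarrow> F x = F y" for F :: "_ \<Rightarrow> real"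
    by (rule integrable_real_mult_indicator[OF J int]) (rule that)
  have D: "A x - B x = A y - B y" if "\<And>i. i \<in> {1..n} \<Longrightarrow> x i = y i" for x y
    using A[of x y] B[of x y] that by simp
  have DP: "(A x - B x) * P x = (A y - B y) * P y" if "\<And>i. i \<in> {1..n} \<Longrightarrow> x i = y i" for x y
    using D[of x y] P[of x y] that by simp
  have "(\<integral>\<omega>. exp (t * real (hawkes \<xi> (n + Suc m) \<omega>)) \<partial>M) =
      (\<integral>\<omega>. exp (t * real (hawkes \<xi> (Suc n) \<omega>)) * future_mgf \<beta> t m (past (?\<xi> \<omega>) (Suc n)) \<partial>M)"
    using Suc.IH[of "Suc n"] by simp
  \<comment> \<open>Writing both cases as \<open>B\<close> plus a multiple of the jump indicator
    isolates the one term to which \<open>integral_jump\<close> applies.\<close>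
  also have "\<dots> = (\<integral>\<omega>. B (?\<xi> \<omega>) + (A (?\<xi> \<omega>) - B (?\<xi> \<omega>)) * indicator ?J \<omega> \<partial>M)"
  proof (rule Bochner_Integration.integral_cong[OF refl])
    fix \<omega> assume w: "\<omega> \<in> space M"
    show "exp (t * real (hawkes \<xi> (Suc n) \<omega>)) * future_mgf \<beta> t m (past (?\<xi> \<omega>) (Suc n)) =
        B (?\<xi> \<omega>) + (A (?\<xi> \<omega>) - B (?\<xi> \<omega>)) * indicator ?J \<omega>"
      using binary_value[of "Suc n" \<omega>] w
      by (auto simp: A_def B_def E_def hawkes_def past_Suc distrib_left exp_add indicator_def)
  qed
  also have "\<dots> = (\<integral>\<omega>. B (?\<xi> \<omega>) \<partial>M) + (\<integral>\<omega>. (A (?\<xi> \<omega>) - B (?\<xi> \<omega>)) * indicator ?J \<omega> \<partial>M)"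
    by (rule Bochner_Integration.integral_add[OF int[of B, OF B] intJ[of "\<lambda>x. A x - B x", OF D]])
  also have "(\<integral>\<omega>. (A (?\<xi> \<omega>) - B (?\<xi> \<omega>)) * indicator ?J \<omega> \<partial>M) =
      (\<integral>\<omega>. (A (?\<xi> \<omega>) - B (?\<xi> \<omega>)) * P (?\<xi> \<omega>) \<partial>M)"
    unfolding P_def by (rule integral_jump[of n "\<lambda>x. A x - B x", OF D])
  also have "(\<integral>\<omega>. B (?\<xi> \<omega>) \<partial>M) + (\<integral>\<omega>. (A (?\<xi> \<omega>) - B (?\<xi> \<omega>)) * P (?\<xi> \<omega>) \<partial>M) =
      (\<integral>\<omega>. B (?\<xi> \<omega>) + (A (?\<xi> \<omega>) - B (?\<xi> \<omega>)) * P (?\<xi> \<omega>) \<partial>M)"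
    by (rule Bochner_Integration.integral_add[symmetric,
          OF int[of B, OF B] int[of "\<lambda>x. (A x - B x) * P x", OF DP]])
  also have "\<dots> = (\<integral>\<omega>. exp (t * real (hawkes \<xi> n \<omega>)) *
      future_mgf \<beta> t (Suc m) (past (?\<xi> \<omega>) n) \<partial>M)"
    by (intro Bochner_Integration.integral_cong[OF refl])
       (simp add: A_def B_def P_def E_def hawkes_def algebra_simps)
  finally show ?case .
qed simp

section \<open>Submultiplicativity and the lower bound\<close>

lemma integral_exp_hawkes: "(\<integral>\<omega>. exp (t * real (hawkes \<xi> m \<omega>)) \<partial>M) = future_mgf \<beta> t m {}"
  using integral_exp_hawkes_add[of t 0 m] by (simp add: hawkes_def prob_space)

lemma integrable_exp_hawkes:
  "integrable M (\<lambda>\<omega>. exp (t * real (hawkes \<xi> n \<omega>)))"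
  using integrable_history[of "Suc n" "\<lambda>x. exp (t * real (\<Sum>i=1..n. x i))"]
  by (simp add: hawkes_def)

text \<open>The empty set is the least past, so it gives the largest future factor. That factor is
  constant, leaves the integral, and equals the transform of a process started afresh.\<close>

lemma integral_exp_hawkes_submult:
  assumes "\<And>i. \<beta> i \<ge> 0" "summable \<beta>" "(\<Sum>i. \<beta> i) \<le> 1" "t \<le> 0"
  shows "(\<integral>\<omega>. exp (t * real (hawkes \<xi> (n + m) \<omega>)) \<partial>M) \<le>
    (\<integral>\<omega>. exp (t * real (hawkes \<xi> n \<omega>)) \<partial>M) * (\<integral>\<omega>. exp (t * real (hawkes \<xi> m \<omega>)) \<partial>M)"
proof -
  have "(\<integral>\<omega>. exp (t * real (hawkes \<xi> (n + m) \<omega>)) \<partial>M) \<le>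
      (\<integral>\<omega>. exp (t * real (hawkes \<xi> n \<omega>)) * future_mgf \<beta> t m {} \<partial>M)"
    unfolding integral_exp_hawkes_add
    by (rule integral_mono_AE')
       (auto simp: integrable_exp_hawkes assms intro!: mult_left_mono future_mgf_antimono
        mult_nonneg_nonneg future_mgf_nonneg)
  then show ?thesis by (simp add: integral_exp_hawkes)
qed

lemma hawkes_le: "\<omega> \<in> space M \<Longrightarrow> hawkes \<xi> n \<omega> \<le> n"
proof -
  assume "\<omega> \<in> space M"
  then have "\<xi> i \<omega> \<le> 1" if "i \<in> {1..n}" for i
    using binary_value[of i \<omega>] that by auto
  then have "hawkes \<xi> n \<omega> \<le> (\<Sum>i=1..n. 1)"
    unfolding hawkes_def by (rule sum_mono)
  then show ?thesis by simp
qed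

lemma integral_exp_hawkes_ge:
  assumes "t \<le> 0"
  shows "exp (t * real n) \<le> (\<integral>\<omega>. exp (t * real (hawkes \<xi> n \<omega>)) \<partial>M)"
  using assms
  by (intro integral_ge_const integrable_exp_hawkes AE_I2)
     (auto intro!: mult_left_mono_neg hawkes_le)

end

section \<open>Convergence of the normalized logarithms\<close>

theorem mainTheorem6:
  fixes M :: "'a measure" and \<beta> :: "nat \<Rightarrow> real" and \<xi> :: "nat \<Rightarrow> 'a \<Rightarrow> nat" and t :: real
  assumes "\<And>i. \<beta> i > 0"
    and "summable \<beta>" and "(\<Sum>i. \<beta> i) < 1"
    and "dthp M \<beta> \<xi>"
    and "t < 0"
  shows "\<exists>\<Gamma>::real. (\<lambda>n. log_mgf M (hawkes \<xi>) n t) \<longlonglongrightarrow> \<Gamma>"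
proof -
  interpret dthp M \<beta> \<xi> by fact
  define a where "a n = (\<integral>\<omega>. exp (t * real (hawkes \<xi> n \<omega>)) \<partial>M)" for n
  \<comment> \<open>This bound is used twice: it makes \<open>a n\<close> positive, so that
    logarithms turn products into sums, and it keeps \<open>ln (a n) / n\<close> above
    \<open>t\<close>, so that the limiting infimum is finite.\<close>
  have lower: "exp (t * real n) \<le> a n" for n
    using integral_exp_hawkes_ge[of t n] assms(5) by (simp add: a_def)
  have pos: "a n > 0" for n
    using lower[of n] exp_gt_zero less_le_trans by blast
  have mult: "a (m + n) \<le> a m * a n" for m n
    unfolding a_def using assms by (intro integral_exp_hawkes_submult) (auto intro: less_imp_le)
  have sub: "ln (a (m + n)) \<le> ln (a m) + ln (a n)" for m n
    using mult[of m n] pos[of "m + n"] ln_mult_pos[OF pos pos, of m n]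
    by (metis ln_mono)
  have "t \<le> ln (a n) / real n" if "n \<ge> 1" for n
    using lower[of n] pos[of n] that by (simp add: field_simps ln_ge_iff)
  then have "bdd_below ((\<lambda>n. ln (a n) / real n) ` {1..})"
    by (intro bdd_belowI[of _ t]) auto
  from subadditive_fekete[of "\<lambda>n. ln (a n)", OF sub this]
  show ?thesis
    unfolding log_mgf_def a_def[symmetric] by auto
qed

end
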